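(* Let $G_1$ and $G_2$ be two graphs, and let $V(\Gamma_1),\ldots,V(\Gamma_{t+t'-q})$, the families $X_i$ ($i\in I$) and the numbers $\varepsilon_i$ be as defined in the context. Then $D'(G_1+G_2)\leq\min\{\varepsilon_i\}_{i\in I}$.
   Context: All graphs are finite and simple. The join $G=G_1+G_2$ of $G_1=(V_1,E_1)$, $G_2=(V_2,E_2)$ (disjoint) has vertex set $V_1\cup V_2$ and edge set $E_1\cup E_2\cup\{uv:u\in V_1,v\in V_2\}$. The distinguishing index $D'(X)$ is the least $d$ such that $X$ has an edge colouring with $d$ colours preserved by no non-identity automorphism. $G[X]$ is an induced subgraph; $\overline{N_G(v)}=V(G)\setminus N_G(v)$ where $N_G(v)$ is the neighbourhood of $v$. Partition of $V_1$: choose $v_1\in V_1$, set $A:=\overline{N_G(v_1)}$; while some vertex $v$ of $G$ satisfies $\overline{N_G(v)}\cap A\neq\emptyset$ and $\overline{N_G(v)}\not\subseteq A$, replace $A$ by $A\cup\overline{N_G(v)}$; the final set is $A_1$. Choose a vertex of $V_1$ outside $A_1$ and repeat to get $A_2$, etc., giving $V_1=A_1\cup\cdots\cup A_k$; the same procedure gives $V_2=B_1\cup\cdots\cup B_{k'}$. Partition $\{G[A_1],\ldots,G[A_k]\}$ into isomorphism classes $\mathcal{A}_1,\ldots,\mathcal{A}_t$ and $\{G[B_1],\ldots,G[B_{k'}]\}$ into isomorphism classes $\mathcal{B}_1,\ldots,\mathcal{B}_{t'}$. Let $q$ be the number of classes $\mathcal{A}_i$ whose members are isomorphic to the members of some $\mathcal{B}_j$,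 indexed so that for $1\leq i\leq q$ members of $\mathcal{A}_i$ are isomorphic to members of $\mathcal{B}_i$ and no other such isomorphisms occur. Set $\Gamma_i=\mathcal{A}_i\cup\mathcal{B}_i$ for $1\leq i\leq q$, $\Gamma_{q+i}=\mathcal{A}_{q+i}$ for $1\leq i\leq t-q$, and $\Gamma_{t+i}=\mathcal{B}_{q+i}$ for $1\leq i\leq t'-q$, and let $V(\Gamma_s)$ be the union of the vertex sets of the graphs in $\Gamma_s$. For $s\neq s'$, $K_{|V(\Gamma_s)|,|V(\Gamma_{s'})|}$ denotes the complete bipartite graph with parts $V(\Gamma_s)$ and $V(\Gamma_{s'})$. Let $X_i$, $i\in I$, range over all sets of such complete bipartite graphs (each with two distinct parts $V(\Gamma_s)\neq V(\Gamma_{s'})$) such that the set of all parts used by members of $X_i$ is exactly $\{V(\Gamma_1),\ldots,V(\Gamma_{t+t'-q})\}$. Put $\varepsilon_i=\max\{D'(K_{|V(\Gamma_s)|,|V(\Gamma_{s'})|}): K_{|V(\Gamma_s)|,|V(\Gamma_{s'})|}\in X_i\}$. *)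

theory Defs
  imports Main "HOL-Library.Extended_Nat"
begin

type_synonym 'a ugraph = "'a set \<times> 'a set set"

abbreviation verts :: "'a ugraph \<Rightarrow> 'a set" where "verts \<equiv> fst"
abbreviation edges :: "'a ugraph \<Rightarrow> 'a set set" where "edges \<equiv> snd"

definition simple_graph :: "'a ugraph \<Rightarrow> bool" where
  "simple_graph G \<longleftrightarrow> finite (verts G) \<and> (\<forall>e\<in>edges G. e \<subseteq> verts G \<and> card e = 2)"

definition graph_join :: "'a ugraph \<Rightarrow> 'a ugraph \<Rightarrow> 'a ugraph" where
  "graph_join G H =
     (verts G \<union> verts H,
      edges G \<union> edges H \<union> {{u, v} | u v. u \<in> verts G \<and> v \<in> verts H})"

definition induced :: "'a ugraph \<Rightarrow> 'a set \<Rightarrow> 'a ugraph" where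
  "induced G S = (S, {e \<in> edges G. e \<subseteq> S})"

definition complete_bipartite :: "'a set \<Rightarrow> 'a set \<Rightarrow> 'a ugraph" where
  "complete_bipartite P Q = (P \<union> Q, {{u, v} | u v. u \<in> P \<and> v \<in> Q})"

definition graph_iso :: "('a \<Rightarrow> 'b) \<Rightarrow> 'a ugraph \<Rightarrow> 'b ugraph \<Rightarrow> bool" where
  "graph_iso f G H \<longleftrightarrow>
     bij_betw f (verts G) (verts H) \<and>
     (\<forall>u\<in>verts G. \<forall>v\<in>verts G. {u, v} \<in> edges G \<longleftrightarrow> {f u, f v} \<in> edges H)"

definition isomorphic :: "'a ugraph \<Rightarrow> 'b ugraph \<Rightarrow> bool" where
  "isomorphic G H \<longleftrightarrow> (\<exists>f. graph_iso f G H)"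

abbreviation automorphism :: "('a \<Rightarrow> 'a) \<Rightarrow> 'a ugraph \<Rightarrow> bool" where
  "automorphism f G \<equiv> graph_iso f G G"

text \<open>Automorphisms are total functions of which only the values on the vertex set matter, so
  being the identity is required on the vertices only.\<close>

definition distinguishing_colouring :: "'a ugraph \<Rightarrow> nat \<Rightarrow> ('a set \<Rightarrow> nat) \<Rightarrow> bool" where
  "distinguishing_colouring G d c \<longleftrightarrow>
     (\<forall>e\<in>edges G. c e < d) \<and>
     (\<forall>f. automorphism f G \<and> (\<forall>e\<in>edges G. c (f ` e) = c e) \<longrightarrow> (\<forall>v\<in>verts G. f v = v))"

text \<open>The value is \<open>\<infinity>\<close> if there is no such colouring for any number of colours, as for
  the complete graph on two vertices.\<close>

definition dist_index :: "'a ugraph \<Rightarrow> enat" where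
  "dist_index G = Inf (enat ` {d. \<exists>c. distinguishing_colouring G d c})"

definition nbhd :: "'a ugraph \<Rightarrow> 'a \<Rightarrow> 'a set" where
  "nbhd G v = {u \<in> verts G. {v, u} \<in> edges G}"

definition non_nbhd :: "'a ugraph \<Rightarrow> 'a \<Rightarrow> 'a set" where
  "non_nbhd G v = verts G - nbhd G v"

text \<open>\<open>grows G v A\<close>: the set \<open>A\<close> occurs at some stage of a run of the while loop started from
  the vertex \<open>v\<close>.\<close>

inductive grows :: "'a ugraph \<Rightarrow> 'a \<Rightarrow> 'a set \<Rightarrow> bool" for G v where
  start: "grows G v (non_nbhd G v)"
| step: "\<lbrakk>grows G v A; w \<in> verts G; non_nbhd G w \<inter> A \<noteq> {}; \<not> non_nbhd G w \<subseteq> A\<rbrakk>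
    \<Longrightarrow> grows G v (A \<union> non_nbhd G w)"

definition final_set :: "'a ugraph \<Rightarrow> 'a \<Rightarrow> 'a set \<Rightarrow> bool" where
  "final_set G v A \<longleftrightarrow>
     grows G v A \<and> \<not> (\<exists>w\<in>verts G. non_nbhd G w \<inter> A \<noteq> {} \<and> \<not> non_nbhd G w \<subseteq> A)"

text \<open>\<open>partial_run G V [A\<^sub>1, \<dots>, A\<^sub>k]\<close>: the list is produced by the first \<open>k\<close> rounds of the
  partitioning procedure for \<open>V\<close>, for some choice of the starting vertices. In a
  \<open>partition_run\<close> no vertex of \<open>V\<close> is left to start another round.\<close>

inductive partial_run :: "'a ugraph \<Rightarrow> 'a set \<Rightarrow> 'a set list \<Rightarrow> bool" for G V where
  Nil: "partial_run G V []"
| snoc: "\<lbrakk>partial_run G V As; v \<in> V - \<Union> (set As); final_set G v A\<rbrakk>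
    \<Longrightarrow> partial_run G V (As @ [A])"

definition partition_run :: "'a ugraph \<Rightarrow> 'a set \<Rightarrow> 'a set list \<Rightarrow> bool" where
  "partition_run G V As \<longleftrightarrow> partial_run G V As \<and> V \<subseteq> \<Union> (set As)"

definition iso_classes :: "'a ugraph set \<Rightarrow> 'a ugraph set set" where
  "iso_classes S = S // {(H, K). H \<in> S \<and> K \<in> S \<and> isomorphic H K}"

definition classes_match :: "'a ugraph set \<Rightarrow> 'a ugraph set \<Rightarrow> bool" where
  "classes_match \<A> \<B> \<longleftrightarrow> (\<exists>H\<in>\<A>. \<exists>K\<in>\<B>. isomorphic H K)"

text \<open>The family of the classes \<open>\<Gamma>\<^sub>s\<close>: unions of matching classes of both sides, then the
  unmatched classes of either side. The indexing by \<open>s\<close> is immaterial.\<close>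

definition Gamma_classes :: "'a ugraph \<Rightarrow> 'a set list \<Rightarrow> 'a set list \<Rightarrow> 'a ugraph set set" where
  "Gamma_classes G As Bs =
     (let AA = iso_classes (induced G ` set As);
          BB = iso_classes (induced G ` set Bs)
      in {\<A> \<union> \<B> | \<A> \<B>. \<A> \<in> AA \<and> \<B> \<in> BB \<and> classes_match \<A> \<B>} \<union>
         {\<A> \<in> AA. \<forall>\<B>\<in>BB. \<not> classes_match \<A> \<B>} \<union>
         {\<B> \<in> BB. \<forall>\<A>\<in>AA. \<not> classes_match \<A> \<B>})"

definition Gamma_parts :: "'a ugraph \<Rightarrow> 'a set list \<Rightarrow> 'a set list \<Rightarrow> 'a set set" where
  "Gamma_parts G As Bs = (\<lambda>\<Gamma>. \<Union> (verts ` \<Gamma>)) ` Gamma_classes G As Bs"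

text \<open>The families \<open>X\<^sub>i\<close> for a given set of parts. Complete bipartite graphs are undirected, so
  \<open>complete_bipartite P Q\<close> and \<open>complete_bipartite Q P\<close> are the same member. For pairwise disjoint
  nonempty parts the graph determines its two parts. With a single nonempty part there is no such
  family, and an infimum over the families in \<^typ>\<open>enat\<close> is \<open>\<infinity>\<close>; otherwise it is a
  minimum.\<close>

definition bipartite_covers :: "'a set set \<Rightarrow> 'a ugraph set set" where
  "bipartite_covers \<P> =
     {X. X \<subseteq> {complete_bipartite P Q | P Q. P \<in> \<P> \<and> Q \<in> \<P> \<and> P \<noteq> Q} \<and>
         {P \<in> \<P>. \<exists>Q\<in>\<P>. P \<noteq> Q \<and> complete_bipartite P Q \<in> X} = \<P>}"

definition cover_index :: "'a ugraph set \<Rightarrow> enat" where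
  "cover_index X = Max (dist_index ` X)"

end

theory Submission
  imports Defs
begin

text \<open>The sets produced by the partitioning procedure are the connected components of the
  complement of the join \<open>G\<close>, so each \<open>V(\<Gamma>\<^sub>s)\<close> collects the co-components of one
  isomorphism type. An automorphism of \<open>G\<close> permutes the co-components and respects their isomorphism
  type, hence it maps every \<open>V(\<Gamma>\<^sub>s)\<close> onto itself. Vertices of distinct parts are adjacent, and
  therefore an automorphism of \<open>G\<close> restricts to each complete bipartite graph of a family \<open>X\<close>.
  Colouring these edge-disjoint subgraphs by distinguishing colourings, and all other edges
  arbitrarily, thus forces a colour-preserving automorphism to fix all vertices of the parts
  used by \<open>X\<close>, which are all vertices.\<close>

section \<open>Isomorphism is an equivalence relation\<close>

lemma isomorphic_refl: "isomorphic G G"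
  unfolding isomorphic_def graph_iso_def by (rule exI[of _ id]) simp

lemma isomorphic_sym:
  assumes "isomorphic G H" shows "isomorphic H G"
proof -
  obtain f where f: "bij_betw f (verts G) (verts H)"
    and e: "\<And>u v. u \<in> verts G \<Longrightarrow> v \<in> verts G \<Longrightarrow> {u, v} \<in> edges G \<longleftrightarrow> {f u, f v} \<in> edges H"
    using assms unfolding isomorphic_def graph_iso_def by blast
  let ?g = "inv_into (verts G) f"
  have "graph_iso ?g H G"
    unfolding graph_iso_def
  proof (intro conjI ballI)
    show "bij_betw ?g (verts H) (verts G)" using f by (rule bij_betw_inv_into)
  next
    fix u v assume "u \<in> verts H" "v \<in> verts H"
    then show "{u, v} \<in> edges H \<longleftrightarrow> {?g u, ?g v} \<in> edges G"
      using e[of "?g u" "?g v"] bij_betw_apply[OF bij_betw_inv_into[OF f]]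
      by (simp add: bij_betw_inv_into_right[OF f])
  qed
  then show ?thesis unfolding isomorphic_def by blast
qed

lemma isomorphic_trans:
  assumes "isomorphic G H" "isomorphic H K" shows "isomorphic G K"
proof -
  obtain f g where fg: "graph_iso f G H" "graph_iso g H K"
    using assms unfolding isomorphic_def by blast
  then have "\<And>u. u \<in> verts G \<Longrightarrow> f u \<in> verts H"
    unfolding graph_iso_def by (meson bij_betw_apply)
  with fg have "graph_iso (g \<circ> f) G K"
    unfolding graph_iso_def by (auto intro: bij_betw_trans)
  then show ?thesis unfolding isomorphic_def by blast
qed

section \<open>Isomorphism classes and the classes \<open>\<Gamma>\<^sub>s\<close>\<close>

lemma iso_classes_eq: "iso_classes S = (\<lambda>H. {K \<in> S. isomorphic H K}) ` S"
  unfolding iso_classes_def quotient_def by auto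

text \<open>An isomorphism type occurs on both sides, only on the left or only on the right, and
  these are the three cases of the definition. The two sides can therefore be merged into one
  collection and classified at once.\<close>

lemma Gamma_classes_eq:
  "Gamma_classes G As Bs = iso_classes (induced G ` (set As \<union> set Bs))"
proof -
  define S T where "S = induced G ` set As" and "T = induced G ` set Bs"
  \<comment> \<open>Here \<open>H\<close> need not belong to \<open>S\<close>. The class of
    \<open>H\<close> can thus be cut down to either side, and an empty cut says that the type is
    missing there.\<close>
  define c where "c S H = {K \<in> S. isomorphic H K}" for S :: "'a ugraph set" and H :: "'a ugraph"
  have c_eq: "c U H = c U K" if "isomorphic H K" for U H K
    using that unfolding c_def by (auto intro: isomorphic_trans isomorphic_sym)
  have c_Un: "c (S \<union> T) H = c S H \<union> c T H" for H
    unfolding c_def by auto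
  have ic: "iso_classes U = c U ` U" for U
    unfolding c_def by (rule iso_classes_eq)
  have match: "classes_match (c S H) (c T K) \<longleftrightarrow> isomorphic H K"
    if "H \<in> S" "K \<in> T" for H K
  proof
    assume "classes_match (c S H) (c T K)"
    then obtain H' K' where "H' \<in> S" "K' \<in> T" "isomorphic H H'" "isomorphic H' K'" "isomorphic K K'"
      unfolding classes_match_def c_def by blast
    then show "isomorphic H K" by (meson isomorphic_trans isomorphic_sym)
  next
    assume "isomorphic H K"
    then show "classes_match (c S H) (c T K)"
      using that isomorphic_refl unfolding classes_match_def c_def by blast
  qed
  \<comment> \<open>The three families of the definition are re-indexed by representatives;
    \<open>match\<close> removes the dependence on the members chosen.\<close>
  have "{A \<union> B | A B. A \<in> c S ` S \<and> B \<in> c T ` T \<and> classes_match A B} =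
      {c S H \<union> c T K | H K. H \<in> S \<and> K \<in> T \<and> isomorphic H K}"
    using match by blast
  moreover have "{A \<in> c S ` S. \<forall>B\<in>c T ` T. \<not> classes_match A B} =
      c S ` {H \<in> S. \<forall>K\<in>T. \<not> isomorphic H K}"
    by (simp add: Compr_image_eq match cong: conj_cong)
  moreover have "{B \<in> c T ` T. \<forall>A\<in>c S ` S. \<not> classes_match A B} =
      c T ` {K \<in> T. \<forall>H\<in>S. \<not> isomorphic H K}"
    by (simp add: Compr_image_eq match cong: conj_cong)
  ultimately have "Gamma_classes G As Bs =
      {c S H \<union> c T K | H K. H \<in> S \<and> K \<in> T \<and> isomorphic H K} \<union>
      c S ` {H \<in> S. \<forall>K\<in>T. \<not> isomorphic H K} \<union>
      c T ` {K \<in> T. \<forall>H\<in>S. \<not> isomorphic H K}" (is "_ = ?L")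
    unfolding Gamma_classes_def Let_def S_def[symmetric] T_def[symmetric] ic by simp
  also have "\<dots> = c (S \<union> T) ` (S \<union> T)"
  proof (intro equalityI subsetI)
    fix x assume "x \<in> ?L"
    then consider (both) H K where "x = c S H \<union> c T K" "H \<in> S" "K \<in> T" "isomorphic H K"
      | (left) H where "x = c S H" "H \<in> S" "\<forall>K\<in>T. \<not> isomorphic H K"
      | (right) K where "x = c T K" "K \<in> T" "\<forall>H\<in>S. \<not> isomorphic H K"
      by blast
    then show "x \<in> c (S \<union> T) ` (S \<union> T)"
    proof cases
      case both
      then have "x = c (S \<union> T) H" using c_eq[of H K T] c_Un by simp
      then show ?thesis using both by blast
    next
      case left
      then have "c T H = {}" unfolding c_def by blast
      then have "x = c (S \<union> T) H" using left c_Un by simp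
      then show ?thesis using left by blast
    next
      case right
      then have "c S K = {}" unfolding c_def using isomorphic_sym by blast
      then have "x = c (S \<union> T) K" using right c_Un by simp
      then show ?thesis using right by blast
    qed
  next
    fix x assume "x \<in> c (S \<union> T) ` (S \<union> T)"
    then obtain H where H: "x = c (S \<union> T) H" "H \<in> S \<union> T" by blast
    show "x \<in> ?L"
    proof (cases "H \<in> S")
      case True
      show ?thesis
      proof (cases "\<exists>K\<in>T. isomorphic H K")
        case T: True
        then obtain K where K: "K \<in> T" "isomorphic H K" by blast
        then have "x = c S H \<union> c T K" using H c_eq[of H K T] c_Un by simp
        then show ?thesis using True K by blast
      next
        case False
        then have "c T H = {}" unfolding c_def by blast
        then have "x = c S H" using H c_Un by simp
        then show ?thesis using True False by blast
      qed
    next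
      case False
      then have HT: "H \<in> T" using H by blast
      show ?thesis
      proof (cases "\<exists>K\<in>S. isomorphic K H")
        case T: True
        then obtain K where K: "K \<in> S" "isomorphic K H" by blast
        then have "x = c S K \<union> c T H" using H c_eq[of K H S] c_Un by simp
        then show ?thesis using HT K by blast
      next
        case False
        then have "c S H = {}" unfolding c_def using isomorphic_sym by blast
        then have "x = c T H" using H c_Un by simp
        then show ?thesis using HT False by blast
      qed
    qed
  qed
  finally show ?thesis unfolding ic image_Un S_def T_def .
qed

section \<open>Components of the complement graph\<close>

definition co_adj :: "'a ugraph \<Rightarrow> ('a \<times> 'a) set" where
  "co_adj G = {(u, v). u \<in> verts G \<and> v \<in> verts G \<and> {u, v} \<notin> edges G}"

definition co_component :: "'a ugraph \<Rightarrow> 'a \<Rightarrow> 'a set" where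
  "co_component G v = (co_adj G)\<^sup>* `` {v}"

lemma co_adj_sym: "(u, v) \<in> co_adj G \<Longrightarrow> (v, u) \<in> co_adj G"
  by (simp add: co_adj_def insert_commute)

lemma co_adj_rtrancl_sym: "(u, v) \<in> (co_adj G)\<^sup>* \<Longrightarrow> (v, u) \<in> (co_adj G)\<^sup>*"
  by (meson co_adj_sym sym_def sym_rtrancl)

lemma non_nbhd_iff: "w \<in> verts G \<Longrightarrow> x \<in> non_nbhd G w \<longleftrightarrow> (w, x) \<in> co_adj G"
  by (auto simp: non_nbhd_def nbhd_def co_adj_def)

lemma co_component_self: "v \<in> co_component G v"
  by (simp add: co_component_def)

lemma co_component_eq:
  assumes "u \<in> co_component G v" shows "co_component G u = co_component G v"
  using assms co_adj_rtrancl_sym[of v u G] unfolding co_component_def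
  by (auto intro: rtrancl_trans)

lemma co_component_subset:
  assumes "v \<in> verts G" shows "co_component G v \<subseteq> verts G"
proof
  fix u assume "u \<in> co_component G v"
  then have "(v, u) \<in> (co_adj G)\<^sup>*" by (simp add: co_component_def)
  then show "u \<in> verts G" using assms by cases (auto simp: co_adj_def)
qed

text \<open>Each pass of the loop adds the complement-neighbours of a vertex that has one of them in
  \<open>A\<close>, so \<open>A\<close> never leaves the component; when the loop stops,
  \<open>A\<close> is closed under \<open>co_adj\<close>.\<close>

lemma final_set_co_component:
  assumes v: "v \<in> verts G" and loop_free: "\<And>w. {w} \<notin> edges G" and fin: "final_set G v A"
  shows "A = co_component G v"
proof
  \<comment> \<open>Since \<open>{w, w} = {w}\<close> is no edge, every vertex lies in its own
    non-neighbourhood.\<close>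
  have refl: "(w, w) \<in> co_adj G" if "w \<in> verts G" for w
    using that loop_free by (simp add: co_adj_def)
  have "grows G v A" using fin by (simp add: final_set_def)
  then have A: "v \<in> A \<and> A \<subseteq> co_component G v"
  proof induction
    case start
    then show ?case using v refl by (auto simp: non_nbhd_iff co_component_def)
  next
    case (step A w)
    then obtain x where "x \<in> non_nbhd G w" "x \<in> co_component G v" by blast
    then have "(w, x) \<in> co_adj G" "(v, x) \<in> (co_adj G)\<^sup>*"
      using step.hyps by (simp_all add: non_nbhd_iff co_component_def)
    \<comment> \<open>The added vertex \<open>w\<close> is reached through the common element
      \<open>x\<close>, and its non-neighbours are then one step further.\<close>
    then have "(v, w) \<in> (co_adj G)\<^sup>*" by (meson co_adj_sym rtrancl.rtrancl_into_rtrancl)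
    then have "non_nbhd G w \<subseteq> co_component G v"
      using step.hyps unfolding co_component_def
      by (auto simp: non_nbhd_iff intro: rtrancl.rtrancl_into_rtrancl)
    then show ?case using step.IH by blast
  qed
  show "A \<subseteq> co_component G v" using A by blast
  show "co_component G v \<subseteq> A"
  proof
    fix u assume "u \<in> co_component G v"
    then have "(v, u) \<in> (co_adj G)\<^sup>*" by (simp add: co_component_def)
    then show "u \<in> A"
    proof induction
      case base
      show ?case using A by blast
    next
      case (step y z)
      have y: "y \<in> verts G" using step.hyps(2) by (simp add: co_adj_def)
      \<comment> \<open>So \<open>non_nbhd G y\<close> meets \<open>A\<close> in \<open>y\<close>,
        and termination of the loop forces it into \<open>A\<close>.\<close>
      then have "y \<in> non_nbhd G y" using refl by (simp add: non_nbhd_iff)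
      then have "non_nbhd G y \<subseteq> A"
        using fin step.IH y unfolding final_set_def by blast
      then show ?case using step.hyps(2) y by (auto simp: non_nbhd_iff)
    qed
  qed
qed

text \<open>The choice of starting vertices is irrelevant: every round yields a component, the run
  covers \<open>V\<close>, and components sharing a vertex coincide.\<close>

lemma partition_run_co_components:
  assumes run: "partition_run G V As" and V: "V \<subseteq> verts G"
    and loop_free: "\<And>w. {w} \<notin> edges G"
  shows "set As = co_component G ` V"
proof
  have "partial_run G V As" using run by (simp add: partition_run_def)
  then show sub: "set As \<subseteq> co_component G ` V"
  proof induction
    case Nil
    show ?case by simp
  next
    case (snoc As v A)
    then have v: "v \<in> V" by simp
    with V have "A = co_component G v"
      using final_set_co_component[OF _ loop_free snoc.hyps(3)] by blast
    then show ?case using v snoc.IH by simp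
  qed
  show "co_component G ` V \<subseteq> set As"
  proof
    fix C assume "C \<in> co_component G ` V"
    then obtain v where v: "v \<in> V" "C = co_component G v" by blast
    then obtain A where A: "A \<in> set As" "v \<in> A"
      using run unfolding partition_run_def by blast
    then obtain w where "A = co_component G w" using sub by blast
    then show "C \<in> set As" using A v co_component_eq by metis
  qed
qed

section \<open>The parts \<open>V(\<Gamma>\<^sub>s)\<close>, indexed by vertices\<close>

definition co_type :: "'a ugraph \<Rightarrow> 'a \<Rightarrow> 'a set" where
  "co_type G v = {u \<in> verts G. isomorphic (induced G (co_component G v))
                                          (induced G (co_component G u))}"

text \<open>A vertex \<open>u\<close> of some component has that component as its
  \<open>co_component\<close>, so the union over the class of \<open>v\<close> can be tested vertex
  by vertex. Hence \<open>co_type G v\<close> is the part containing \<open>v\<close>.\<close>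

lemma Gamma_parts_eq:
  assumes "set As \<union> set Bs = co_component G ` verts G"
  shows "Gamma_parts G As Bs = co_type G ` verts G"
proof -
  have "\<Union> (verts ` {K \<in> induced G ` co_component G ` verts G.
      isomorphic (induced G (co_component G v)) K}) = co_type G v" (is "?L = _") for v
  proof (intro equalityI subsetI)
    fix u assume "u \<in> ?L"
    then obtain w where w: "w \<in> verts G" "u \<in> co_component G w"
      "isomorphic (induced G (co_component G v)) (induced G (co_component G w))"
      by (auto simp: induced_def)
    then show "u \<in> co_type G v"
      using co_component_eq[of u G w] co_component_subset[of w G] by (auto simp: co_type_def)
  next
    fix u assume "u \<in> co_type G v"
    moreover have "u \<in> verts (induced G (co_component G u))"
      by (simp add: induced_def co_component_self)
    ultimately show "u \<in> ?L" unfolding co_type_def by blast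
  qed
  then show ?thesis
    unfolding Gamma_parts_def Gamma_classes_eq iso_classes_eq assms by (simp add: image_image)
qed

lemma co_type_self: "v \<in> verts G \<Longrightarrow> v \<in> co_type G v"
  by (simp add: co_type_def isomorphic_refl)

lemma co_type_subset: "co_type G v \<subseteq> verts G"
  by (auto simp: co_type_def)

lemma co_type_eq:
  assumes "u \<in> co_type G v" shows "co_type G u = co_type G v"
  using assms unfolding co_type_def by (auto intro: isomorphic_trans isomorphic_sym)

text \<open>Membership in a part becomes an equation between types, a form in which invariance under
  automorphisms can be used by rewriting.\<close>

lemma co_type_iff:
  "v \<in> verts G \<Longrightarrow> u \<in> co_type G v \<longleftrightarrow> u \<in> verts G \<and> co_type G u = co_type G v"
  using co_type_eq[of u G v] co_type_self[of u G] co_type_subset[of G v] by (metis subsetD)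

text \<open>Non-adjacent vertices share a co-component and hence a type.\<close>

lemma co_type_adjacent:
  assumes "u \<in> verts G" "v \<in> verts G" "co_type G u \<noteq> co_type G v"
  shows "{u, v} \<in> edges G"
proof (rule ccontr)
  assume "{u, v} \<notin> edges G"
  then have "v \<in> co_component G u" using assms by (auto simp: co_component_def co_adj_def)
  then have "co_component G v = co_component G u" by (rule co_component_eq)
  then show False using assms(3) by (simp add: co_type_def)
qed

text \<open>Automorphisms preserve and reflect non-adjacency, so walks in the complement can be
  pushed forward and pulled back.\<close>

lemma automorphism_co_component:
  assumes f: "automorphism f G" and v: "v \<in> verts G"
  shows "f ` co_component G v = co_component G (f v)"
proof -
  have adj: "(f x, f y) \<in> co_adj G \<longleftrightarrow> (x, y) \<in> co_adj G"
    if "x \<in> verts G" "y \<in> verts G" for x y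
    using that f bij_betw_apply[of f "verts G" "verts G"]
    by (auto simp: graph_iso_def co_adj_def)
  show ?thesis
  proof (intro equalityI subsetI)
    fix z assume "z \<in> f ` co_component G v"
    then obtain x where x: "z = f x" "(v, x) \<in> (co_adj G)\<^sup>*" by (auto simp: co_component_def)
    from x(2) have "(f v, f x) \<in> (co_adj G)\<^sup>*"
    proof induction
      case base
      show ?case by simp
    next
      case (step y z)
      then have "(f y, f z) \<in> co_adj G" using adj by (simp add: co_adj_def)
      then show ?case using step.IH by simp
    qed
    then show "z \<in> co_component G (f v)" using x by (simp add: co_component_def)
  next
    fix z assume "z \<in> co_component G (f v)"
    then have "(f v, z) \<in> (co_adj G)\<^sup>*" by (simp add: co_component_def)
    then show "z \<in> f ` co_component G v"
    proof induction
      case base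
      show ?case by (simp add: co_component_self)
    next
      case (step y z)
      then obtain x where x: "y = f x" "x \<in> co_component G v" by blast
      have "z \<in> verts G" using step.hyps(2) by (simp add: co_adj_def)
      \<comment> \<open>Surjectivity of \<open>f\<close> on the vertices supplies the next vertex of
        the pulled-back walk.\<close>
      then obtain w where w: "z = f w" "w \<in> verts G"
        using f unfolding graph_iso_def bij_betw_def by blast
      have "x \<in> verts G" using x(2) co_component_subset[OF v] by blast
      then have "(x, w) \<in> co_adj G" using step.hyps(2) x(1) w adj by simp
      then have "w \<in> co_component G v" using x(2) unfolding co_component_def by auto
      then show ?case using w(1) by simp
    qed
  qed
qed

text \<open>Restricted to the component of \<open>v\<close>, the automorphism is an isomorphism onto
  the component of \<open>f v\<close>.\<close>

lemma automorphism_co_type: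
  assumes f: "automorphism f G" and v: "v \<in> verts G"
  shows "f v \<in> co_type G v"
proof -
  let ?C = "co_component G v"
  have C: "?C \<subseteq> verts G" using v by (rule co_component_subset)
  have fV: "bij_betw f (verts G) (verts G)" using f by (simp add: graph_iso_def)
  have "bij_betw f ?C (co_component G (f v))"
    using automorphism_co_component[OF f v] C fV by (metis bij_betw_subset)
  then have "graph_iso f (induced G ?C) (induced G (co_component G (f v)))"
    using f C bij_betw_apply unfolding graph_iso_def induced_def by fastforce
  then show ?thesis
    using v bij_betw_apply[OF fV v] unfolding co_type_def isomorphic_def by blast
qed

section \<open>Distinguishing colourings and the index\<close>

lemma dist_index_le_obtain:
  assumes "dist_index K \<le> enat d"
  obtains c where "distinguishing_colouring K d c"
proof -
  let ?S = "enat ` {d. \<exists>c. distinguishing_colouring K d c}"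
  \<comment> \<open>The infimum of the empty set in \<open>enat\<close> is
    \<open>\<infinity>\<close>, which a finite bound excludes; a nonempty set attains its infimum by
    well-ordering.\<close>
  have "?S \<noteq> {}"
  proof
    assume "?S = {}"
    then have "dist_index K = \<infinity>" unfolding dist_index_def Inf_enat_def by simp
    then show False using assms by simp
  qed
  then obtain x where "x \<in> ?S" by blast
  then have "(LEAST x. x \<in> ?S) \<in> ?S" by (rule LeastI)
  then have "Inf ?S \<in> ?S" using \<open>?S \<noteq> {}\<close> unfolding Inf_enat_def by simp
  then obtain d' c where "dist_index K = enat d'" "distinguishing_colouring K d' c"
    unfolding dist_index_def by auto
  \<comment> \<open>The number of colours enters only as an upper bound, so a palette of size
    \<open>d'\<close> may be enlarged to \<open>d\<close>.\<close>
  then have "distinguishing_colouring K d c"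
    using assms unfolding distinguishing_colouring_def by (auto intro: less_le_trans)
  then show thesis by (rule that)
qed

lemma dist_index_leI: "distinguishing_colouring G d c \<Longrightarrow> dist_index G \<le> enat d"
  unfolding dist_index_def by (rule Inf_lower) blast

text \<open>The bound for a single family; the minimum over all families follows formally.\<close>

lemma dist_index_le_cover_index:
  assumes G: "simple_graph G" and X: "X \<in> bipartite_covers (co_type G ` verts G)"
  shows "dist_index G \<le> cover_index X"
proof (cases "verts G = {} \<or> cover_index X = \<infinity>")
  case True
  \<comment> \<open>For the empty graph \<open>X\<close> is empty and \<open>cover_index X\<close> is the junk value \<open>Max {}\<close>.\<close>
  have "dist_index G \<le> 0" if "verts G = {}"
  proof -
    have "edges G = {}" using G that unfolding simple_graph_def by fastforce
    then show ?thesis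
      using dist_index_leI[of G 0] that by (simp add: distinguishing_colouring_def zero_enat_def)
  qed
  then show ?thesis using True by (metis enat_ord_code(3) order_trans zero_le)
next
  case False
  then obtain d where d: "cover_index X = enat d" by auto
  have fin: "finite (verts G)" using G by (simp add: simple_graph_def)
  let ?P = "co_type G ` verts G"
  have X_sub: "\<exists>P\<in>?P. \<exists>Q\<in>?P. P \<noteq> Q \<and> K = complete_bipartite P Q" if "K \<in> X" for K
    using that X unfolding bipartite_covers_def by blast
  have X_cov: "\<exists>Q\<in>?P. P \<noteq> Q \<and> complete_bipartite P Q \<in> X" if "P \<in> ?P" for P
    using that X unfolding bipartite_covers_def by blast
  \<comment> \<open>Finiteness of \<open>X\<close> makes \<open>Max\<close> a true maximum, so that
    one palette of \<open>d\<close> colours serves all members.\<close>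
  have "X \<subseteq> (\<lambda>(P, Q). complete_bipartite P Q) ` (?P \<times> ?P)"
    using X_sub by fastforce
  then have "finite X" by (rule finite_subset) (use fin in auto)
  then have "\<exists>c. distinguishing_colouring K d c" if "K \<in> X" for K
    using dist_index_le_obtain[of K d] that d unfolding cover_index_def
    by (metis Max_ge finite_imageI image_eqI)
  then obtain c where c: "\<And>K. K \<in> X \<Longrightarrow> distinguishing_colouring K d (c K)" by metis
  \<comment> \<open>The types of its two ends determine the member that contains an edge. This makes
    the members edge-disjoint and \<open>col\<close> well defined.\<close>
  have edge: "\<exists>u v. e = {u, v} \<and> u \<in> verts G \<and> v \<in> verts G \<and> co_type G u \<noteq> co_type G v \<and>
      K = complete_bipartite (co_type G u) (co_type G v)"
    if "K \<in> X" "e \<in> edges K" for K e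
  proof -
    obtain p q where pq: "p \<in> verts G" "q \<in> verts G" "co_type G p \<noteq> co_type G q"
      "K = complete_bipartite (co_type G p) (co_type G q)"
      using X_sub[OF \<open>K \<in> X\<close>] by blast
    then obtain u v where uv: "e = {u, v}" "u \<in> co_type G p" "v \<in> co_type G q"
      using \<open>e \<in> edges K\<close> by (auto simp: complete_bipartite_def)
    then have "u \<in> verts G" "v \<in> verts G"
      "co_type G u = co_type G p" "co_type G v = co_type G q"
      using pq(1,2) by (simp_all add: co_type_iff)
    then show ?thesis using pq uv(1) by (intro exI[of _ u] exI[of _ v]) simp
  qed
  have cb_sym: "complete_bipartite P Q = complete_bipartite Q P" for P Q :: "'a set"
    unfolding complete_bipartite_def by (auto simp: insert_commute)
  have unique: "K = L" if KL: "K \<in> X" "e \<in> edges K" "L \<in> X" "e \<in> edges L" for K L e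
  proof -
    obtain u v where uv: "e = {u, v}" "K = complete_bipartite (co_type G u) (co_type G v)"
      using edge[OF KL(1,2)] by blast
    obtain x y where xy: "e = {x, y}" "L = complete_bipartite (co_type G x) (co_type G y)"
      using edge[OF KL(3,4)] by blast
    have "u = x \<and> v = y \<or> u = y \<and> v = x" using uv(1) xy(1) by (auto simp: doubleton_eq_iff)
    then show ?thesis using uv(2) xy(2) cb_sym by auto
  qed
  define col where
    "col e = (if \<exists>K\<in>X. e \<in> edges K then c (THE K. K \<in> X \<and> e \<in> edges K) e else 0)" for e
  have col: "col e = c K e" if K: "K \<in> X" "e \<in> edges K" for K e
  proof -
    have "(THE K. K \<in> X \<and> e \<in> edges K) = K"
    proof (rule the_equality)
      show "L = K" if "L \<in> X \<and> e \<in> edges L" for L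
        using unique[of L e K] that K by blast
    qed (use K in blast)
    then show ?thesis using K unfolding col_def by auto
  qed
  have cK: "c K e < d" if "K \<in> X" "e \<in> edges K" for K e
    using c that unfolding distinguishing_colouring_def by blast
  have "distinguishing_colouring G d col"
    unfolding distinguishing_colouring_def
  proof (intro conjI ballI allI impI)
    fix e
    \<comment> \<open>Colour 0, the default outside the members of \<open>X\<close>, is admissible
      only if \<open>0 < d\<close>. As \<open>G\<close> has a vertex, some member of
      \<open>X\<close> has an edge, whose colour is below \<open>d\<close>.\<close>
    obtain v w where vw: "v \<in> verts G" "w \<in> verts G"
      "complete_bipartite (co_type G v) (co_type G w) \<in> X"
      using False X_cov by blast
    then have "{v, w} \<in> edges (complete_bipartite (co_type G v) (co_type G w))"
      using co_type_self[of v G] co_type_self[of w G] by (auto simp: complete_bipartite_def)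
    then have "0 < d" using cK[OF vw(3)] gr_zeroI by fastforce
    then show "col e < d"
    proof (cases "\<exists>K\<in>X. e \<in> edges K")
      case True
      then obtain K where "K \<in> X" "e \<in> edges K" by blast
      then show ?thesis using col[of K e] cK[of K e] by simp
    qed (simp add: col_def)
  next
    fix f v
    assume f: "automorphism f G \<and> (\<forall>e\<in>edges G. col (f ` e) = col e)" and v: "v \<in> verts G"
    obtain w where w: "w \<in> verts G" "co_type G v \<noteq> co_type G w"
      and K: "complete_bipartite (co_type G v) (co_type G w) \<in> X" (is "?K \<in> X")
      using v X_cov by blast
    have VK: "verts ?K = co_type G v \<union> co_type G w"
      by (simp add: complete_bipartite_def)
    have VKG: "verts ?K \<subseteq> verts G" by (simp add: VK co_type_subset)
    have f_type: "co_type G (f u) = co_type G u" if "u \<in> verts G" for u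
      using co_type_eq[OF automorphism_co_type[OF conjunct1[OF f] that]] .
    have inj: "inj_on f (verts G)" and fV: "\<And>u. u \<in> verts G \<Longrightarrow> f u \<in> verts G"
      using f unfolding graph_iso_def bij_betw_def by auto
    note type_iff = co_type_iff[OF v] co_type_iff[OF w(1)]
    have VK_iff:
      "u \<in> verts ?K \<longleftrightarrow> u \<in> verts G \<and> (co_type G u = co_type G v \<or> co_type G u = co_type G w)"
      for u
      unfolding VK using type_iff by auto
    \<comment> \<open>Inside \<open>?K\<close> adjacency depends on types alone, and
      \<open>f\<close> preserves types; hence \<open>f\<close> preserves the edges of
      \<open>?K\<close>.\<close>
    have edge_iff: "{a, b} \<in> edges ?K \<longleftrightarrow> co_type G a \<noteq> co_type G b"
      if ab: "a \<in> verts ?K" "b \<in> verts ?K" for a b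
    proof -
      have "{a, b} \<in> edges ?K \<longleftrightarrow>
          a \<in> co_type G v \<and> b \<in> co_type G w \<or> b \<in> co_type G v \<and> a \<in> co_type G w"
        unfolding complete_bipartite_def by (auto simp: doubleton_eq_iff)
      also have "\<dots> \<longleftrightarrow> co_type G a = co_type G v \<and> co_type G b = co_type G w \<or>
          co_type G b = co_type G v \<and> co_type G a = co_type G w"
        using ab unfolding VK_iff by (simp add: type_iff)
      also have "\<dots> \<longleftrightarrow> co_type G a \<noteq> co_type G b"
        using ab w(2) unfolding VK_iff by metis
      finally show ?thesis .
    qed
    have f_VK: "f u \<in> verts ?K" if "u \<in> verts ?K" for u
      using that fV f_type unfolding VK_iff by simp
    \<comment> \<open>An injective self-map of a finite set is onto.\<close>
    have "bij_betw f (verts ?K) (verts ?K)"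
      unfolding bij_betw_def
      using endo_inj_surj[of "verts ?K" f] f_VK inj_on_subset[OF inj VKG] finite_subset[OF VKG fin]
      by blast
    moreover have "{a, b} \<in> edges ?K \<longleftrightarrow> {f a, f b} \<in> edges ?K"
      if ab: "a \<in> verts ?K" "b \<in> verts ?K" for a b
    proof -
      have "a \<in> verts G" "b \<in> verts G" using ab VKG by auto
      then show ?thesis using edge_iff[OF ab] edge_iff[OF f_VK[OF ab(1)] f_VK[OF ab(2)]] f_type
        by simp
    qed
    ultimately have aut: "automorphism f ?K" by (simp add: graph_iso_def)
    have "c ?K (f ` e) = c ?K e" if e: "e \<in> edges ?K" for e
    proof -
      obtain a b where ab: "e = {a, b}" "a \<in> co_type G v" "b \<in> co_type G w"
        using e by (auto simp: complete_bipartite_def)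
      then have "{f a, f b} \<in> edges ?K"
        using aut e unfolding graph_iso_def VK by simp
      \<comment> \<open>Invariance of \<open>col\<close> is assumed on edges of \<open>G\<close>
        only; both \<open>e\<close> and its image lie in \<open>?K\<close>, where \<open>col\<close>
        agrees with \<open>c ?K\<close>.\<close>
      moreover have "e \<in> edges G"
        using ab w(2) by (simp add: type_iff co_type_adjacent)
      ultimately show ?thesis using f col[OF K] e ab(1) by fastforce
    qed
    then have "\<forall>u\<in>verts ?K. f u = u"
      using c[OF K] aut unfolding distinguishing_colouring_def by blast
    then show "f v = v" using v co_type_self[OF v] VK by simp
  qed
  then show ?thesis using d dist_index_leI by metis
qed

section \<open>Application to the join\<close>

lemma simple_graph_join:
  assumes "simple_graph G" "simple_graph H" "verts G \<inter> verts H = {}"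
  shows "simple_graph (graph_join G H)"
proof -
  have "card {u, v} = 2" if "u \<in> verts G" "v \<in> verts H" for u v
  proof -
    have "u \<noteq> v" using that assms(3) by blast
    then show ?thesis by simp
  qed
  then show ?thesis using assms(1,2) by (auto simp: simple_graph_def graph_join_def)
qed

theorem theorem3p8:
  fixes G\<^sub>1 G\<^sub>2 :: "'a ugraph"
    and As Bs :: "'a set list"
  assumes "simple_graph G\<^sub>1" and "simple_graph G\<^sub>2"
    and "verts G\<^sub>1 \<inter> verts G\<^sub>2 = {}"
    and "partition_run (graph_join G\<^sub>1 G\<^sub>2) (verts G\<^sub>1) As"
    and "partition_run (graph_join G\<^sub>1 G\<^sub>2) (verts G\<^sub>2) Bs"
  shows "dist_index (graph_join G\<^sub>1 G\<^sub>2)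
    \<le> (INF X \<in> bipartite_covers (Gamma_parts (graph_join G\<^sub>1 G\<^sub>2) As Bs). cover_index X)"
proof -
  let ?G = "graph_join G\<^sub>1 G\<^sub>2"
  have V: "verts ?G = verts G\<^sub>1 \<union> verts G\<^sub>2" by (simp add: graph_join_def)
  have G: "simple_graph ?G" using assms(1-3) by (rule simple_graph_join)
  then have loop_free: "{w} \<notin> edges ?G" for w
    unfolding simple_graph_def by fastforce
  have "set As \<union> set Bs = co_component ?G ` verts ?G"
    using partition_run_co_components[OF assms(4) _ loop_free]
      partition_run_co_components[OF assms(5) _ loop_free] V by auto
  then have "Gamma_parts ?G As Bs = co_type ?G ` verts ?G" by (rule Gamma_parts_eq)
  \<comment> \<open>If there is no family, the infimum is \<open>\<infinity>\<close>;
    \<open>INF_greatest\<close> covers this case as well.\<close>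
  then show ?thesis by (auto intro!: INF_greatest dist_index_le_cover_index[OF G])
qed

end
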